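(* Let $f\in C_c(\mathcal{X})$ and let $\phi$ be a strongly convex function such that its Legendre–Fenchel dual $\phi^\star$ admits a generalised inverse ${\phi^\star}^{-1}(t)=\inf\{s:\phi^\star(s)\ge t\}$. Let $\psi^\star:\mathcal{M}(\mathcal{X})\to\mathbb{R}$ be the Legendre–Fenchel dual of $\psi:C_c(\mathcal{X})\to\mathbb{R}$. If $$\psi(\lambda f)\le \phi(\lambda)\quad\text{for every }\lambda>0,$$ then, for every measure $\nu$ such that $\nu(f)<+\infty$ and ${\phi'}^{-1}\big({\phi^\star}^{-1}(\psi^\star(\nu))\big)>0$, $$\nu(f)\le {\phi^\star}^{-1}\big(\psi^\star(\nu)\big).$$
   Context: $\mathcal{X}$ is the underlying space, $C_c(\mathcal{X})$ is the space of continuous compactly supported real functions on $\mathcal{X}$, and $\mathcal{M}(\mathcal{X})$ is the set of all signed measures on $\mathcal{X}$; the measures $\nu$ in the claim are elements of $\mathcal{M}(\mathcal{X})$. For a measure $\nu$ and a function $g$, $\nu(g)=\int g\,d\nu$. The Legendre–Fenchel dual of $\psi$ is $\psi^\star(\nu)=\sup_{g\in C_c(\mathcal{X})}\{\nu(g)-\psi(g)\}$ for $\nu\in\mathcal{M}(\mathcal{X})$. The function $\phi$ is a real function of a real variable, and its Legendre–Fenchel dual is $\phi^\star(s)=\sup_{x\in\mathbb{R}}\{sx-\phi(x)\}$. $\phi'$ is the derivative of $\phi$ and ${\phi'}^{-1}$ denotes the inverse function of $\phi'$. *)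

theory Defs
  imports "HOL-Analysis.Analysis"
begin

definition C_c :: "('a::topological_space \<Rightarrow> real) set" where
  "C_c = {g. continuous_on UNIV g \<and> compact (closure {x. g x \<noteq> 0})}"

(* Signed Borel measures in the textbook sense: countably additive and extended-valued, but
   attaining at most one of the values +oo and -oo. Values off the Borel sets are irrelevant. *)
definition signed_measures :: "('a::topological_space set \<Rightarrow> ereal) set" where
  "signed_measures = {\<nu>.
     \<nu> {} = 0 \<and>
     ((\<forall>A\<in>sets borel. \<nu> A \<noteq> \<infinity>) \<or> (\<forall>A\<in>sets borel. \<nu> A \<noteq> -\<infinity>)) \<and>
     (\<forall>A :: nat \<Rightarrow> 'a set. range A \<subseteq> sets borel \<longrightarrow> disjoint_family A \<longrightarrow>
        (\<lambda>i. \<nu> (A i)) sums \<nu> (\<Union>i. A i))}"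

(* The positive part of the Jordan decomposition; the negative part is the one of - \<nu>. *)
definition positive_variation :: "('a::topological_space set \<Rightarrow> ereal) \<Rightarrow> 'a measure" where
  "positive_variation \<nu> = measure_of UNIV (sets borel)
     (\<lambda>A. e2ennreal (SUP B \<in> {B \<in> sets borel. B \<subseteq> A}. \<nu> B))"

lemma signed_add:
  assumes "\<nu> \<in> signed_measures" "A \<in> sets borel" "B \<in> sets borel" "A \<inter> B = {}"
  shows "\<nu> (A \<union> B) = \<nu> A + \<nu> B"
proof -
  have 0: "\<nu> {} = 0" using assms by (auto simp: signed_measures_def)
  have r: "range (binaryset A B) \<subseteq> sets borel"
    using assms by (simp add: range_binaryset_eq)
  have d: "disjoint_family (binaryset A B)"
    using assms(4) by (simp add: disjoint_family_on_def binaryset_def inf_commute)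
  have "(\<lambda>i. \<nu> (binaryset A B i)) sums \<nu> (\<Union>i. binaryset A B i)"
    using assms(1) r d unfolding signed_measures_def mem_Collect_eq by blast
  moreover have "(\<lambda>i. \<nu> (binaryset A B i)) sums (\<nu> A + \<nu> B)"
  proof -
    have "(\<lambda>i. \<nu> (binaryset A B i)) sums (\<Sum>i\<in>{0,1}. \<nu> (binaryset A B i))"
      by (rule sums_finite) (auto simp: binaryset_def 0)
    then show ?thesis by (simp add: binaryset_def)
  qed
  ultimately show ?thesis
    by (metis UN_binaryset_eq sums_unique2)
qed

(* The set function in the definition of positive_variation is indeed a measure, so that measure_of
   does not fall back to the zero measure. *)
lemma emeasure_positive_variation:
  assumes nu: "\<nu> \<in> signed_measures" and A: "A \<in> sets borel"
  shows "emeasure (positive_variation \<nu>) A = e2ennreal (SUP B \<in> {B \<in> sets borel. B \<subseteq> A}. \<nu> B)"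
proof -
  define P where "P A = e2ennreal (SUP B \<in> {B \<in> sets borel. B \<subseteq> A}. \<nu> B)" for A
  have 0: "\<nu> {} = 0" using nu by (auto simp: signed_measures_def)
  have ge0: "(SUP B \<in> {B \<in> sets borel. B \<subseteq> A}. \<nu> B) \<ge> 0" for A
    by (rule SUP_upper2[of "{}"]) (auto simp: 0)
  have least: "P A \<le> x" if "\<And>B. B \<in> sets borel \<Longrightarrow> B \<subseteq> A \<Longrightarrow> \<nu> B \<le> enn2ereal x" for A x
  proof -
    have *: "(SUP B \<in> {B \<in> sets borel. B \<subseteq> A}. \<nu> B) \<le> enn2ereal x"
      by (rule SUP_least) (use that in auto)
    show ?thesis unfolding P_def using e2ennreal_mono[OF *] by (simp only: e2ennreal_enn2ereal)
  qed
  have Pmono: "P A \<le> P B" if "A \<subseteq> B" for A B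
    unfolding P_def by (rule e2ennreal_mono, rule SUP_subset_mono) (use that in auto)
  have nuP: "\<nu> B \<le> enn2ereal (P A)" if "B \<in> sets borel" "B \<subseteq> A" for A B
    unfolding P_def using ge0[of A] that by (auto simp: enn2ereal_e2ennreal intro: SUP_upper)
  have e2add: "e2ennreal (x + y) = e2ennreal x + e2ennreal y" if "0 \<le> x" "0 \<le> y" for x y
    by (rule enn2ereal_inject[THEN iffD1]) (use that in \<open>simp add: plus_ennreal.rep_eq enn2ereal_e2ennreal\<close>)
  have sup: "P A + P B \<le> P (A \<union> B)" if AB: "A \<inter> B = {}" for A B
  proof -
    have 1: "\<nu> C + \<nu> D \<le> enn2ereal (P (A \<union> B))"
      if "C \<in> sets borel" "D \<in> sets borel" "C \<subseteq> A" "D \<subseteq> B" for C D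
    proof -
      have "\<nu> C + \<nu> D = \<nu> (C \<union> D)" using signed_add[OF nu that(1,2)] that(3,4) AB by (metis Int_mono subset_empty)
      also have "\<dots> \<le> enn2ereal (P (A \<union> B))" by (rule nuP) (use that in auto)
      finally show ?thesis .
    qed
    let ?S = "\<lambda>A. SUP B \<in> {B \<in> sets borel. B \<subseteq> A}. \<nu> B"
    have 2: "?S A + \<nu> D \<le> enn2ereal (P (A \<union> B))" if "D \<in> sets borel" "D \<subseteq> B" "\<nu> D \<ge> 0" for D
    proof -
      have "?S A + \<nu> D = (SUP C \<in> {C \<in> sets borel. C \<subseteq> A}. \<nu> C + \<nu> D)"
        by (rule SUP_ereal_add_left[symmetric]) (use that in auto)
      also have "\<dots> \<le> enn2ereal (P (A \<union> B))" by (rule SUP_least) (use that 1 in auto)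
      finally show ?thesis .
    qed
    have 3: "?S A + ?S B \<le> enn2ereal (P (A \<union> B))"
    proof -
      have "?S A + ?S B = (SUP D \<in> {D \<in> sets borel. D \<subseteq> B}. ?S A + \<nu> D)"
        by (rule SUP_ereal_add_right[symmetric]) (use ge0[of A] in \<open>auto\<close>)
      also have "\<dots> \<le> enn2ereal (P (A \<union> B))"
      proof (rule SUP_least)
        fix D :: "'a set" assume D: "D \<in> {D \<in> sets borel. D \<subseteq> B}"
        show "?S A + \<nu> D \<le> enn2ereal (P (A \<union> B))"
        proof (cases "\<nu> D \<ge> 0")
          case True then show ?thesis using 2 D by auto
        next
          case False
          then have "?S A + \<nu> D \<le> ?S A + \<nu> {}" by (intro add_left_mono) (auto simp: 0)
          also have "\<dots> \<le> enn2ereal (P (A \<union> B))" by (rule 2) (auto simp: 0)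
          finally show ?thesis .
        qed
      qed
      finally show ?thesis .
    qed
    have "P A + P B = e2ennreal (?S A + ?S B)"
      unfolding P_def by (rule e2add[symmetric, OF ge0 ge0])
    also have "\<dots> \<le> P (A \<union> B)" using e2ennreal_mono[OF 3] by (simp only: e2ennreal_enn2ereal)
    finally show ?thesis .
  qed
  have ca: "countably_additive (sets borel) P"
    unfolding countably_additive_def
  proof (intro allI impI)
    fix A :: "nat \<Rightarrow> 'a set"
    assume A: "range A \<subseteq> sets borel" "disjoint_family A" "(\<Union>i. A i) \<in> sets borel"
    have "(\<Sum>i<n. P (A i)) \<le> P (\<Union>i<n. A i)" for n
    proof (induction n)
      case (Suc n)
      have "A i \<inter> A n = {}" if "i < n" for i
        using A(2) that by (simp add: disjoint_family_on_def)
      then have dn: "(\<Union>i<n. A i) \<inter> A n = {}" by blast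
      have "(\<Sum>i<Suc n. P (A i)) \<le> P (\<Union>i<n. A i) + P (A n)" using Suc by (simp add: add_right_mono)
      also have "\<dots> \<le> P ((\<Union>i<n. A i) \<union> A n)"
        by (rule sup[OF dn])
      also have "(\<Union>i<n. A i) \<union> A n = (\<Union>i<Suc n. A i)" by (auto simp: less_Suc_eq)
      finally show ?case .
    qed simp
    then have "(\<Sum>i<n. P (A i)) \<le> P (\<Union>i. A i)" for n
      by (rule order_trans) (rule Pmono, auto)
    then have a: "(\<Sum>i. P (A i)) \<le> P (\<Union>i. A i)" by (simp add: suminf_le_const)
    have b: "P (\<Union>i. A i) \<le> (\<Sum>i. P (A i))"
    proof (rule least)
      fix B :: "'a set" assume B: "B \<in> sets borel" "B \<subseteq> (\<Union>i. A i)"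
      have dis: "disjoint_family (\<lambda>i. B \<inter> A i)" using A(2) unfolding disjoint_family_on_def by blast
      have rg: "range (\<lambda>i. B \<inter> A i) \<subseteq> sets borel" using A(1) B(1) by auto
      have s0: "(\<lambda>i. \<nu> (B \<inter> A i)) sums \<nu> (\<Union>i. B \<inter> A i)"
        using nu rg dis unfolding signed_measures_def mem_Collect_eq by blast
      have "(\<Union>i. B \<inter> A i) = B" using B(2) by auto
      with s0 have s: "(\<lambda>i. \<nu> (B \<inter> A i)) sums \<nu> B" by simp
      have "(\<Sum>i<n. \<nu> (B \<inter> A i)) \<le> enn2ereal (\<Sum>i. P (A i))" for n
      proof -
        have "(\<Sum>i<n. \<nu> (B \<inter> A i)) \<le> (\<Sum>i<n. enn2ereal (P (A i)))"
          by (intro sum_mono nuP) (use A(1) B in auto)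
        also have "\<dots> = enn2ereal (\<Sum>i<n. P (A i))" by (simp add: sum_enn2ereal)
        also have "\<dots> \<le> enn2ereal (\<Sum>i. P (A i))" by (simp add: less_eq_ennreal.rep_eq[symmetric] sum_le_suminf)
        finally show ?thesis .
      qed
      then show "\<nu> B \<le> enn2ereal (\<Sum>i. P (A i))"
        using s unfolding sums_def by (intro LIMSEQ_le_const2) auto
    qed
    from a b show "(\<Sum>i. P (A i)) = P (\<Union>i. A i)" by simp
  qed
  have pos: "positive (sets borel) P"
    unfolding positive_def P_def by (simp add: 0 Collect_conv_if zero_ereal_def e2ennreal_ereal)
  have "emeasure (measure_of UNIV (sets borel) P) A = P A"
    by (rule emeasure_measure_of_sigma) (use ca pos A sets.sigma_algebra_axioms[of borel] in auto)
  then show ?thesis unfolding positive_variation_def P_def .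
qed

definition negative_variation :: "('a::topological_space set \<Rightarrow> ereal) \<Rightarrow> 'a measure" where
  "negative_variation \<nu> = positive_variation (\<lambda>A. - \<nu> A)"

(* The integral of g with respect to \<nu>, as an extended real; ennreal truncates negative arguments
   to 0, so "ennreal (g x)" and "ennreal (- g x)" are the positive and negative parts of g.
   An undefined difference (oo - oo = oo in ereal) is harmless in legendre_dual_fun below: it can
   only occur if the integral of the positive part of g, or of its negation, is +oo as well, and
   then the supremum is +oo anyway. *)
definition signed_integral :: "('a::topological_space set \<Rightarrow> ereal) \<Rightarrow> ('a \<Rightarrow> real) \<Rightarrow> ereal" where
  "signed_integral \<nu> g =
     enn2ereal ((\<integral>\<^sup>+x. ennreal (g x) \<partial>positive_variation \<nu>) + (\<integral>\<^sup>+x. ennreal (- g x) \<partial>negative_variation \<nu>))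
   - enn2ereal ((\<integral>\<^sup>+x. ennreal (- g x) \<partial>positive_variation \<nu>) + (\<integral>\<^sup>+x. ennreal (g x) \<partial>negative_variation \<nu>))"

(* Only the values of \<psi> on C_c matter. *)
definition legendre_dual_fun ::
    "(('a::topological_space \<Rightarrow> real) \<Rightarrow> real) \<Rightarrow> ('a set \<Rightarrow> ereal) \<Rightarrow> ereal" where
  "legendre_dual_fun \<psi> \<nu> = (SUP g\<in>C_c. signed_integral \<nu> g - ereal (\<psi> g))"

(* Functions of a real variable take values in (-oo, +oo], as usual in convex analysis. For a
   function \<phi> that is finite on all of the line, or just at one negative point, its dual tends to
   +oo at -oo, so that no set {s. t \<le> dual s} is bounded below and the generalised inverse never
   exists; the relevant functions are +oo on the negative half-line. *)
definition effective_domain :: "(real \<Rightarrow> ereal) \<Rightarrow> real set" where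
  "effective_domain \<phi> = {x. \<phi> x < \<infinity>}"

definition proper :: "(real \<Rightarrow> ereal) \<Rightarrow> bool" where
  "proper \<phi> \<longleftrightarrow> (\<forall>x. \<phi> x \<noteq> -\<infinity>) \<and> effective_domain \<phi> \<noteq> {}"

definition strongly_convex :: "(real \<Rightarrow> ereal) \<Rightarrow> bool" where
  "strongly_convex \<phi> \<longleftrightarrow> (\<exists>m>0. \<forall>x y u. 0 < u \<and> u < 1 \<longrightarrow>
     \<phi> (u * x + (1 - u) * y) + ereal (m / 2 * u * (1 - u) * (x - y)\<^sup>2)
       \<le> ereal u * \<phi> x + ereal (1 - u) * \<phi> y)"

definition legendre_dual :: "(real \<Rightarrow> ereal) \<Rightarrow> real \<Rightarrow> ereal" where
  "legendre_dual \<phi> s = (SUP x. ereal (s * x) - \<phi> x)"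

(* Inf is the infimum in the reals, meaningful for nonempty sets that are bounded below. *)
definition admits_generalised_inverse_at :: "(real \<Rightarrow> ereal) \<Rightarrow> ereal \<Rightarrow> bool" where
  "admits_generalised_inverse_at h t \<longleftrightarrow> {s. h s \<ge> t} \<noteq> {} \<and> bdd_below {s. h s \<ge> t}"

definition generalised_inverse :: "(real \<Rightarrow> ereal) \<Rightarrow> ereal \<Rightarrow> real" where
  "generalised_inverse h t = Inf {s. h s \<ge> t}"

definition derivative_domain :: "(real \<Rightarrow> ereal) \<Rightarrow> real set" where
  "derivative_domain \<phi> = interior (effective_domain \<phi>)"

definition derivative :: "(real \<Rightarrow> ereal) \<Rightarrow> real \<Rightarrow> real" where
  "derivative \<phi> = deriv (\<lambda>x. real_of_ereal (\<phi> x))"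

definition differentiable_inside :: "(real \<Rightarrow> ereal) \<Rightarrow> bool" where
  "differentiable_inside \<phi> \<longleftrightarrow>
     (\<forall>x\<in>derivative_domain \<phi>. (\<lambda>x. real_of_ereal (\<phi> x)) differentiable (at x))"

(* By strong convexity the derivative is injective on derivative_domain; the inverse is meaningful
   on derivative \<phi> ` derivative_domain \<phi>. *)
definition derivative_inverse :: "(real \<Rightarrow> ereal) \<Rightarrow> real \<Rightarrow> real" where
  "derivative_inverse \<phi> = inv_into (derivative_domain \<phi>) (derivative \<phi>)"

end

theory Submission
  imports Defs
begin

text \<open>
  Let \<open>t\<close> be the dual of \<open>\<psi>\<close> at \<open>\<nu>\<close>, \<open>s\<close> its generalised inverse under the dual of \<open>\<phi>\<close>, and \<open>l > 0\<close>
  the point with \<open>\<phi>' l = s\<close>. Testing the dual of \<open>\<psi>\<close> with \<open>l f\<close> gives \<open>l \<nu>(f) \<le> t + \<phi> l\<close>, so it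
  suffices that \<open>t \<le> s l - \<phi> l\<close>. Strong convexity gives \<open>\<phi> x \<ge> \<phi> l + s (x - l) + m/2 (x - l)\<^sup>2\<close>,
  hence the dual of \<open>\<phi>\<close> at \<open>s'\<close> is at most \<open>s' l - \<phi> l + (s' - s)\<^sup>2 / (2 m)\<close>; letting \<open>s'\<close> tend to
  the infimum \<open>s\<close> of the points where that dual is at least \<open>t\<close> finishes the proof.
\<close>

lemma C_c_cmult:
  assumes "f \<in> C_c" "c \<noteq> 0"
  shows "(\<lambda>x. c * f x) \<in> C_c"
proof -
  have "{x. c * f x \<noteq> 0} = {x. f x \<noteq> 0}" using assms(2) by auto
  then show ?thesis using assms(1) unfolding C_c_def by (auto intro!: continuous_intros)
qed

lemma sets_positive_variation [measurable_cong, simp]: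
  "sets (positive_variation \<nu>) = sets borel"
  unfolding positive_variation_def using sets.sigma_sets_eq[of borel]
  by (simp add: sets_measure_of_conv)

lemma sets_negative_variation [measurable_cong, simp]:
  "sets (negative_variation \<nu>) = sets borel"
  by (simp add: negative_variation_def)

text \<open>For \<open>c > 0\<close> positive and negative parts scale separately, so each of the
  four integrals acquires the factor \<open>c\<close>. The identity survives an undefined
  difference, since both sides are then \<infinity>.\<close>

lemma signed_integral_cmult:
  assumes [measurable]: "f \<in> borel_measurable borel" and "c > 0"
  shows "signed_integral \<nu> (\<lambda>x. c * f x) = ereal c * signed_integral \<nu> f"
proof -
  have "(\<integral>\<^sup>+x. ennreal (c * g x) \<partial>M) = ennreal c * (\<integral>\<^sup>+x. ennreal (g x) \<partial>M)"
    if [measurable]: "g \<in> borel_measurable M" for g :: "'a \<Rightarrow> real" and M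
    using \<open>c > 0\<close> by (simp add: ennreal_mult' nn_integral_cmult)
  note scale = this[of f] this[of "\<lambda>x. - f x", simplified]
  have "enn2ereal (ennreal c * a) - enn2ereal (ennreal c * b)
      = ereal c * (enn2ereal a - enn2ereal b)" for a b
    using \<open>c > 0\<close>
    by (cases a; cases b) (auto simp: times_ennreal.rep_eq algebra_simps enn2ereal_ennreal)
  then show ?thesis
    unfolding signed_integral_def by (simp add: scale distrib_left[symmetric])
qed

lemma proper_finite:
  assumes "proper \<phi>" "\<phi> x < \<infinity>"
  shows "\<phi> x = ereal (real_of_ereal (\<phi> x))"
  using assms unfolding proper_def by (cases "\<phi> x") auto

text \<open>Strong convexity on the segment from \<open>l\<close> to \<open>x\<close>, divided by
  the weight \<open>u\<close> of \<open>x\<close>, bounds a difference quotient at \<open>l\<close>.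
  As \<open>u\<close> tends to 0 the quotient becomes \<open>s * (x - l)\<close>, and the factor
  \<open>1 - u\<close> of the quadratic gap tends to 1, so the full constant \<open>m / 2\<close>
  remains.\<close>

lemma quadratic_tangent_bound:
  assumes pr: "proper \<phi>" and sc: "strongly_convex \<phi>"
    and l: "\<phi> l < \<infinity>"
    and D: "((\<lambda>x. real_of_ereal (\<phi> x)) has_real_derivative s) (at l)"
  obtains m where "m > 0"
    "\<And>x. ereal (real_of_ereal (\<phi> l) + s * (x - l) + m / 2 * (x - l)\<^sup>2) \<le> \<phi> x"
proof -
  obtain m where m: "m > 0" and conv: "\<And>x y u. 0 < u \<Longrightarrow> u < 1 \<Longrightarrow>
     \<phi> (u * x + (1 - u) * y) + ereal (m / 2 * u * (1 - u) * (x - y)\<^sup>2)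
       \<le> ereal u * \<phi> x + ereal (1 - u) * \<phi> y"
    using sc unfolding strongly_convex_def by blast
  define F where "F x = real_of_ereal (\<phi> x)" for x
  note fin = proper_finite[OF pr, folded F_def]
  have "F l + s * (x - l) + m / 2 * (x - l)\<^sup>2 \<le> F x" if x: "\<phi> x < \<infinity>" for x
  proof -
    define h where "h = x - l"
    have step: "(F (l + u * h) - F l) / u + m / 2 * (1 - u) * h\<^sup>2 \<le> F x - F l"
      if u: "0 < u" "u < 1" for u
    proof -
      have eq: "u * x + (1 - u) * l = l + u * h" by (simp add: h_def algebra_simps)
      have c: "\<phi> (l + u * h) + ereal (m / 2 * u * (1 - u) * h\<^sup>2)
          \<le> ereal (u * F x + (1 - u) * F l)"
        using conv[OF u, of x l] fin[OF x] fin[OF l] unfolding eq h_def[symmetric]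
        by (metis plus_ereal.simps(1) times_ereal.simps(1))
      \<comment> \<open>The right-hand side of \<open>c\<close> is real, which forces finiteness at
        the intermediate point and allows passing from \<open>\<phi>\<close> to
        \<open>F\<close>.\<close>
      then have "\<phi> (l + u * h) < \<infinity>" by auto
      from fin[OF this] c have "F (l + u * h) + m / 2 * u * (1 - u) * h\<^sup>2 \<le> u * F x + (1 - u) * F l"
        by (metis ereal_less_eq(3) plus_ereal.simps(1))
      then have "F (l + u * h) - F l + u * (m / 2 * (1 - u) * h\<^sup>2) \<le> u * (F x - F l)"
        by (simp add: algebra_simps)
      then show ?thesis using u(1) by (simp add: field_simps)
    qed
    have "((\<lambda>u. F (l + u * h)) has_real_derivative s * h) (at 0)"
      using D unfolding F_def[symmetric]
      by (auto intro!: derivative_eq_intros DERIV_chain2[where f = F])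
    \<comment> \<open>The limit is one-sided because \<open>step\<close> covers only
      \<open>0 < u < 1\<close>.\<close>
    then have "((\<lambda>u. (F (l + u * h) - F l) / u) \<longlongrightarrow> s * h) (at_right 0)"
      unfolding DERIV_def by (auto intro: tendsto_mono[OF at_le])
    then have "((\<lambda>u. (F (l + u * h) - F l) / u + m / 2 * (1 - u) * h\<^sup>2)
        \<longlongrightarrow> s * h + m / 2 * (1 - 0) * h\<^sup>2) (at_right 0)"
      by (intro tendsto_intros)
    then have "s * h + m / 2 * (1 - 0) * h\<^sup>2 \<le> F x - F l"
      by (intro tendsto_upperbound[where F = "at_right 0"])
         (use step in \<open>auto simp: eventually_at_right_field intro!: exI[of _ 1]\<close>)
    then show ?thesis by (simp add: h_def)
  qed
  then have "ereal (F l + s * (x - l) + m / 2 * (x - l)\<^sup>2) \<le> \<phi> x" for x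
    using fin[of x] by (cases "\<phi> x < \<infinity>") (metis ereal_less_eq(3), auto)
  with m that show thesis unfolding F_def by blast
qed

text \<open>Conjugation reverses order, so a quadratic minorant of \<open>\<phi>\<close> yields a
  quadratic majorant of its dual. Completing the square puts the maximiser at
  \<open>x = l + (s' - s) / m\<close>.\<close>

lemma legendre_dual_quadratic_bound:
  assumes "m > 0" and low: "\<And>x. ereal (a + s * (x - l) + m / 2 * (x - l)\<^sup>2) \<le> \<phi> x"
  shows "legendre_dual \<phi> s' \<le> ereal (s' * l - a + (s' - s)\<^sup>2 / (2 * m))"
  unfolding legendre_dual_def
proof (rule SUP_least)
  fix x
  have "ereal (s' * x) - \<phi> x \<le> ereal (s' * x) - ereal (a + s * (x - l) + m / 2 * (x - l)\<^sup>2)"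
    by (rule ereal_minus_mono[OF order_refl low])
  also have "\<dots> = ereal (s' * x - (a + s * (x - l) + m / 2 * (x - l)\<^sup>2))" by simp
  also have "s' * x - (a + s * (x - l) + m / 2 * (x - l)\<^sup>2)
      = s' * l - a + (s' - s)\<^sup>2 / (2 * m) - (m * (x - l) - (s' - s))\<^sup>2 / (2 * m)"
    using \<open>m > 0\<close> by (simp add: field_simps power2_eq_square)
  also have "ereal \<dots> \<le> ereal (s' * l - a + (s' - s)\<^sup>2 / (2 * m))"
    using \<open>m > 0\<close> by simp
  finally show "ereal (s' * x) - \<phi> x \<le> ereal (s' * l - a + (s' - s)\<^sup>2 / (2 * m))" .
qed

text \<open>The infimum \<open>s\<close> lies in the closure of the superlevel set. The majorant of
  the dual imposes a closed condition on that set, and its error term vanishes at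
  \<open>s' = s\<close>.\<close>

lemma generalised_inverse_dual_bound:
  assumes "admits_generalised_inverse_at (legendre_dual \<phi>) (ereal t)"
    and s: "s = generalised_inverse (legendre_dual \<phi>) (ereal t)"
    and "m > 0" and low: "\<And>x. ereal (a + s * (x - l) + m / 2 * (x - l)\<^sup>2) \<le> \<phi> x"
  shows "t \<le> s * l - a"
proof -
  let ?S = "{s'. legendre_dual \<phi> s' \<ge> ereal t}"
  have "s \<in> closure ?S"
    using assms(1) unfolding s generalised_inverse_def admits_generalised_inverse_at_def
    by (intro closure_contains_Inf) auto
  moreover have "closure ?S \<subseteq> {s'. t \<le> s' * l - a + (s' - s)\<^sup>2 / (2 * m)}"
  proof (rule closure_minimal)
    show "?S \<subseteq> {s'. t \<le> s' * l - a + (s' - s)\<^sup>2 / (2 * m)}"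
      using order_trans[OF _ legendre_dual_quadratic_bound[OF \<open>m > 0\<close> low]] by fastforce
    show "closed {s'. t \<le> s' * l - a + (s' - s)\<^sup>2 / (2 * m)}"
      using \<open>m > 0\<close> by (intro closed_Collect_le continuous_intros) auto
  qed
  ultimately show ?thesis by auto
qed

theorem theorem1:
  fixes f :: "'a::topological_space \<Rightarrow> real"
    and \<phi> :: "real \<Rightarrow> ereal"
    and \<psi> :: "('a \<Rightarrow> real) \<Rightarrow> real"
    and \<nu> :: "'a set \<Rightarrow> ereal"
  assumes "f \<in> C_c"
    and "proper \<phi>" and "strongly_convex \<phi>" and "differentiable_inside \<phi>"
    and "\<forall>l>0. ereal (\<psi> (\<lambda>x. l * f x)) \<le> \<phi> l"
    and "\<nu> \<in> signed_measures"
    and "\<bar>legendre_dual_fun \<psi> \<nu>\<bar> \<noteq> \<infinity>"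
    and "admits_generalised_inverse_at (legendre_dual \<phi>) (legendre_dual_fun \<psi> \<nu>)"
    and "signed_integral \<nu> f < \<infinity>"
    and "generalised_inverse (legendre_dual \<phi>) (legendre_dual_fun \<psi> \<nu>)
           \<in> derivative \<phi> ` derivative_domain \<phi>"
    and "derivative_inverse \<phi> (generalised_inverse (legendre_dual \<phi>) (legendre_dual_fun \<psi> \<nu>)) > 0"
  shows "signed_integral \<nu> f \<le> ereal (generalised_inverse (legendre_dual \<phi>) (legendre_dual_fun \<psi> \<nu>))"
proof -
  define s where "s = generalised_inverse (legendre_dual \<phi>) (legendre_dual_fun \<psi> \<nu>)"
  define l where "l = derivative_inverse \<phi> s"
  define F where "F = (\<lambda>x. real_of_ereal (\<phi> x))"
  obtain t where t: "legendre_dual_fun \<psi> \<nu> = ereal t" using assms(7) by auto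
  have "l > 0" using assms(11) by (simp add: l_def s_def)
  \<comment> \<open>As \<open>s\<close> is a value of the derivative, \<open>inv_into\<close>
    returns a genuine preimage.\<close>
  have dom: "l \<in> derivative_domain \<phi>" and deriv: "derivative \<phi> l = s"
    using assms(10) unfolding l_def s_def derivative_inverse_def
    by (auto intro: inv_into_into f_inv_into_f)
  have fin: "\<phi> l < \<infinity>"
    using dom interior_subset unfolding derivative_domain_def effective_domain_def by blast
  have "(F has_real_derivative s) (at l)"
    using assms(4) dom deriv unfolding differentiable_inside_def derivative_def F_def
    by (metis DERIV_deriv_iff_real_differentiable)
  then obtain m where "m > 0"
    and low: "\<And>x. ereal (F l + s * (x - l) + m / 2 * (x - l)\<^sup>2) \<le> \<phi> x"
    using quadratic_tangent_bound[OF assms(2,3) fin] unfolding F_def by metis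
  have t_le: "t \<le> s * l - F l"
    using generalised_inverse_dual_bound[OF _ _ \<open>m > 0\<close> low] assms(8) by (simp add: t s_def)
  have "f \<in> borel_measurable borel"
    using assms(1) by (simp add: C_c_def borel_measurable_continuous_onI)
  then have up: "ereal l * signed_integral \<nu> f - ereal (\<psi> (\<lambda>x. l * f x)) \<le> ereal t"
    using SUP_upper[OF C_c_cmult[OF assms(1)], of l "\<lambda>g. signed_integral \<nu> g - ereal (\<psi> g)"] \<open>l > 0\<close>
    by (simp add: signed_integral_cmult t[symmetric] legendre_dual_fun_def)
  have le: "\<psi> (\<lambda>x. l * f x) \<le> F l"
    using assms(5) \<open>l > 0\<close> proper_finite[OF assms(2) fin] unfolding F_def
    by (metis ereal_less_eq(3))
  show ?thesis
  \<comment> \<open>A real value lets the factor \<open>l > 0\<close> cancel; \<infinity> is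
    excluded by hypothesis, and the claim is trivial for -\<infinity>.\<close>
  proof (cases "signed_integral \<nu> f")
    case (real r)
    with up have "l * r \<le> t + \<psi> (\<lambda>x. l * f x)" by simp
    also have "\<dots> \<le> l * s" using t_le le by (simp add: mult.commute)
    finally show ?thesis using \<open>l > 0\<close> real by (simp add: s_def)
  qed (use assms(9) in auto)
qed

end
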